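(* Let $X$ be an arbitrary real Banach space (of dimension at least $2$). Then $\lambda_X^-(\varepsilon) \asymp \delta_X(\varepsilon)$ as $\varepsilon \to 0$, and for any $r \in [0,1]$: $$\delta_X(r) \le \lambda_X^-(r) \le \delta_X(2r).$$
   Context: Let $X$ be a real Banach space with $\dim X \ge 2$. Write $S_X=\{x\in X:\|x\|=1\}$ and $B_X=\{x \in X: \|x\|\le 1\}$. For $x\in X\setminus\{0\}$ and $y\in X$, $y$ is quasiorthogonal to $x$, written $y\urcorner x$, if there is a functional $p\in X^*$ with $\|p\|=1$, $p(x)=\|x\|$ and $p(y)=0$. For $x,y\in S_X$ with $y\urcorner x$ and $r\in[0,1]$ put $\lambda_X(x,y,r)=\min\{\lambda\in\mathbb{R}:\ \|x+ry-\lambda x\|=1\}$. The modulus of supporting convexity is $$\lambda_X^-(r)=\inf\{\lambda_X(x,y,r):\ x,y\in S_X,\ y\urcorner x\},\quad r\in[0,1].$$ The modulus of convexity is $\delta_X(\varepsilon)=\inf\{1-\frac{\|x+y\|}{2}:\ x,y\in B_X,\ \|x-y\|\ge\varepsilon\}$, $\varepsilon\in[0,2]$. Two non-negative functions $f,g$, each defined on a segment with left endpoint $0$, are equivalent at zero, written $f(t)\asymp g(t)$ as $t\to0$, if there are positive constants $a,b,c,d,e$ such that $a f(bt)\le g(t)\le c f(dt)$ for all $t\in[0,e]$. *)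

theory Defs
  imports "HOL-Analysis.Analysis"
begin

definition quasiorthogonal :: "'a::real_normed_vector \<Rightarrow> 'a \<Rightarrow> bool" where
  "quasiorthogonal y x \<longleftrightarrow>
     x \<noteq> 0 \<and> (\<exists>p :: 'a \<Rightarrow>\<^sub>L real.
       norm p = 1 \<and> blinfun_apply p x = norm x \<and> blinfun_apply p y = 0)"

text \<open>The minimum below is attained whenever \<open>x\<close>, \<open>y\<close> are unit vectors with \<open>y\<close>
  quasiorthogonal to \<open>x\<close> and \<open>0 \<le> r \<le> 1\<close>: the set is closed, it is bounded, and it meets
  \<open>[0, 1]\<close> by the intermediate value theorem. It may be infinite, so \<open>Min\<close> does not apply.\<close>

definition supporting_lambda :: "'a::real_normed_vector \<Rightarrow> 'a \<Rightarrow> real \<Rightarrow> real" where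
  "supporting_lambda x y r = (LEAST l::real. norm (x + r *\<^sub>R y - l *\<^sub>R x) = 1)"

text \<open>The space is the whole type \<open>'a\<close>, passed as a type argument. The moduli are meaningful
  on \<open>[0, 1]\<close> and \<open>[0, 2]\<close> respectively.\<close>

definition modulus_supporting_convexity :: "'a::real_normed_vector itself \<Rightarrow> real \<Rightarrow> real" where
  "modulus_supporting_convexity X r =
     Inf {supporting_lambda x y r | x y :: 'a.
            x \<in> sphere 0 1 \<and> y \<in> sphere 0 1 \<and> quasiorthogonal y x}"

definition modulus_convexity :: "'a::real_normed_vector itself \<Rightarrow> real \<Rightarrow> real" where
  "modulus_convexity X \<epsilon> =
     Inf {1 - norm (x + y) / 2 | x y :: 'a.
            x \<in> cball 0 1 \<and> y \<in> cball 0 1 \<and> norm (x - y) \<ge> \<epsilon>}"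

text \<open>Equivalence at zero of \<open>f\<close>, defined on \<open>[0, A]\<close>, and \<open>g\<close>, defined on \<open>[0, B]\<close>. HOL
  functions are total, so the domains are explicit and every argument at which \<open>f\<close> or \<open>g\<close>
  is compared is required to lie in the respective domain.\<close>

definition equivalent_at_zero ::
    "real \<Rightarrow> (real \<Rightarrow> real) \<Rightarrow> real \<Rightarrow> (real \<Rightarrow> real) \<Rightarrow> bool" where
  "equivalent_at_zero A f B g \<longleftrightarrow>
     (\<forall>t\<in>{0..A}. 0 \<le> f t) \<and> (\<forall>t\<in>{0..B}. 0 \<le> g t) \<and>
     (\<exists>a b c d e :: real. a > 0 \<and> b > 0 \<and> c > 0 \<and> d > 0 \<and> e > 0 \<and>
        (\<forall>t\<in>{0..e}. t \<in> {0..B} \<and> b * t \<in> {0..A} \<and> d * t \<in> {0..A} \<and>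
           a * f (b * t) \<le> g t \<and> g t \<le> c * f (d * t)))"

end

theory Submission
  imports Defs
begin

text \<open>
  Let \<open>p\<close> support the unit ball at \<open>x\<close> and let \<open>p y = 0\<close>. In the plane of \<open>x\<close> and \<open>y\<close>
  the line \<open>{r y + t x}\<close> meets the ball in a segment, and \<open>1 - supporting_lambda x y r\<close> is
  the largest \<open>t\<close> on it. Hence any point \<open>s x + r y\<close> of the ball gives
  \<open>supporting_lambda x y r \<le> 1 - s\<close> (lemma \<open>supporting_lambda_le\<close>).

  For the lower bound put \<open>l = supporting_lambda x y r\<close>. The points \<open>(1 - l) x + r y\<close>
  and \<open>(1 - l) x\<close> of the ball are at distance \<open>r\<close>, and \<open>p\<close> takes the value \<open>1 - l\<close> on their
  midpoint, so this pair bounds \<open>modulus_convexity\<close> at \<open>r\<close> by \<open>l\<close>.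

  For the upper bound let \<open>u\<close>, \<open>v\<close> be points of the ball with \<open>norm (u - v) \<ge> 2 * r\<close>. Take
  \<open>x\<close> in the direction of the midpoint \<open>(u + v) / 2 = s x\<close>, a support functional \<open>p\<close> at
  \<open>x\<close>, and \<open>y\<close> in the kernel of \<open>p\<close> such that \<open>(u - v) / 2 = a x + b y\<close> with
  \<open>b \<ge> 0\<close>; swapping \<open>u\<close> and \<open>v\<close> makes \<open>a \<ge> 0\<close>. The points \<open>0\<close>, \<open>x\<close>, \<open>y\<close> and \<open>u = (s + a) x + b y\<close> lie in the ball.
  It turns out that their convex hull contains \<open>s x + r y\<close> (lemma \<open>shifted_midpoint_in_ball\<close>),
  because \<open>a x + b y\<close> has norm at least \<open>r\<close>. So \<open>supporting_lambda x y r\<close> is at most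
  \<open>1 - s = 1 - norm (u + v) / 2\<close>.

  Support functionals come from the Hahn-Banach theorem, in the form that a minimal sublinear
  functional is linear. The equivalence at zero is the pair of inequalities, read with
  \<open>t / 2\<close> in place of \<open>r\<close> on one side.
\<close>

section \<open>Support functionals\<close>

definition sublinear :: "('a::real_vector \<Rightarrow> real) \<Rightarrow> bool" where
  "sublinear q \<longleftrightarrow> (\<forall>v w. q (v + w) \<le> q v + q w) \<and> (\<forall>c\<ge>0. \<forall>v. q (c *\<^sub>R v) \<le> c * q v)"

lemma sublinear_zero:
  assumes "sublinear q" shows "q 0 = 0"
proof -
  have "q (0 *\<^sub>R 0) \<le> 0 * q 0" "q (0 + 0) \<le> q 0 + q 0"
    using assms unfolding sublinear_def by blast+
  then show ?thesis by simp
qed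

lemma sublinear_ge_neg:
  assumes "sublinear q" shows "- q (- v) \<le> q v"
proof -
  have "q (v + - v) \<le> q v + q (- v)" using assms unfolding sublinear_def by blast
  then show ?thesis using sublinear_zero[OF assms] by simp
qed

lemma sublinear_scaleR:
  assumes q: "sublinear q" and c: "c \<ge> 0" shows "q (c *\<^sub>R v) = c * q v"
proof (cases "c = 0")
  case True then show ?thesis using sublinear_zero[OF q] by simp
next
  case False
  with c have c: "c > 0" by simp
  have "q (inverse c *\<^sub>R (c *\<^sub>R v)) \<le> inverse c * q (c *\<^sub>R v)"
    using q c unfolding sublinear_def by (meson inverse_nonnegative_iff_nonnegative less_imp_le)
  then have "c * q v \<le> q (c *\<^sub>R v)" using c by (simp add: field_simps)
  moreover have "q (c *\<^sub>R v) \<le> c * q v" using q c unfolding sublinear_def by simp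
  ultimately show ?thesis by simp
qed

text \<open>The two instances used below are infima of chains of sublinear functionals and the functional
  that lowers a given one in a given direction. The existence hypotheses take the place of
  sublinearity of the single \<open>g i\<close>, which fails in the second instance.\<close>

lemma sublinear_INF:
  fixes g :: "'i \<Rightarrow> 'a::real_vector \<Rightarrow> real"
  assumes ne: "I \<noteq> {}"
    and bdd: "\<And>v. bdd_below ((\<lambda>i. g i v) ` I)"
    and add: "\<And>i j v w. i \<in> I \<Longrightarrow> j \<in> I \<Longrightarrow> \<exists>k\<in>I. g k (v + w) \<le> g i v + g j w"
    and scale: "\<And>i c v. i \<in> I \<Longrightarrow> c \<ge> 0 \<Longrightarrow> \<exists>k\<in>I. g k (c *\<^sub>R v) \<le> c * g i v"
  shows "sublinear (\<lambda>v. INF i\<in>I. g i v)"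
proof -
  let ?u = "\<lambda>v. INF i\<in>I. g i v"
  have low: "?u v \<le> g i v" if "i \<in> I" for i v
    using bdd that by (rule cINF_lower)
  have "?u (v + w) \<le> ?u v + ?u w" for v w
  proof -
    have 1: "?u (v + w) \<le> g i v + g j w" if "i \<in> I" "j \<in> I" for i j
      using add[OF that, of v w] low order_trans by blast
    have "?u (v + w) - g i v \<le> ?u w" if "i \<in> I" for i
      using ne 1[OF that] by (intro cINF_greatest) (auto simp: algebra_simps)
    then have "?u (v + w) - ?u w \<le> ?u v"
      using ne by (intro cINF_greatest) (auto simp: algebra_simps)
    then show ?thesis by simp
  qed
  moreover have "?u (c *\<^sub>R v) \<le> c * ?u v" if c: "c \<ge> 0" for c v
  proof -
    have 1: "?u (c *\<^sub>R v) \<le> c * g i v" if "i \<in> I" for i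
      using scale[OF that c, of v] low order_trans by blast
    show ?thesis
    proof (cases "c = 0")
      case True then show ?thesis using 1 ne by auto
    next
      case False
      then have "?u (c *\<^sub>R v) / c \<le> ?u v"
        using ne 1 c by (intro cINF_greatest) (auto simp: field_simps)
      then show ?thesis using False c by (simp add: field_simps)
    qed
  qed
  ultimately show ?thesis unfolding sublinear_def by blast
qed

text \<open>Any linear functional \<open>f \<le> q\<close> with \<open>f a = q a\<close> satisfies
  \<open>f v = f (v + t *\<^sub>R a) - t * q a \<le> q (v + t *\<^sub>R a) - t * q a\<close> for \<open>t \<ge> 0\<close>. The infimum of these
  bounds is itself sublinear, and \<open>-a\<close> already gets the value that forces \<open>f a \<ge> q a\<close>.\<close>

lemma sublinear_lowering:
  assumes q: "sublinear q"
  shows "\<exists>q'. sublinear q' \<and> (\<forall>v. q' v \<le> q v) \<and> (\<forall>v. q' v \<le> q (v + a) - q a)"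
proof -
  define g where "g t v = q (v + t *\<^sub>R a) - t * q a" for t :: real and v
  have add: "q (v + w) \<le> q v + q w" for v w using q unfolding sublinear_def by blast
  have bdd: "bdd_below ((\<lambda>t. g t v) ` {0..})" for v
  proof (rule bdd_belowI2)
    fix t :: real assume "t \<in> {0..}"
    then have "t * q a = q (t *\<^sub>R a)" using sublinear_scaleR[OF q] by simp
    also have "\<dots> \<le> q (v + t *\<^sub>R a) + q (- v)" using add[of "v + t *\<^sub>R a" "- v"] by simp
    finally show "- q (- v) \<le> g t v" unfolding g_def by simp
  qed
  have "sublinear (\<lambda>v. INF t\<in>{0..}. g t v)"
  proof (rule sublinear_INF)
    fix s t :: real and v w assume st: "s \<in> {0..}" "t \<in> {0..}"
    have "g (s + t) (v + w) \<le> g s v + g t w"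
      using add[of "v + s *\<^sub>R a" "w + t *\<^sub>R a"] unfolding g_def by (simp add: algebra_simps)
    then show "\<exists>k\<in>{0..}. g k (v + w) \<le> g s v + g t w" using st by force
  next
    fix t c :: real and v assume t: "t \<in> {0..}" and c: "c \<ge> 0"
    have "g (c * t) (c *\<^sub>R v) \<le> c * g t v"
      using sublinear_scaleR[OF q c, of "v + t *\<^sub>R a"] unfolding g_def by (simp add: algebra_simps)
    then show "\<exists>k\<in>{0..}. g k (c *\<^sub>R v) \<le> c * g t v" using t c by force
  qed (use bdd in auto)
  moreover have "(INF t\<in>{0..}. g t v) \<le> g t v" if "t \<ge> 0" for t v
    using bdd that by (intro cINF_lower) auto
  from this[of 0] this[of 1] have "(INF t\<in>{0..}. g t v) \<le> q v"
    "(INF t\<in>{0..}. g t v) \<le> q (v + a) - q a" for v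
    by (simp_all add: g_def)
  ultimately show ?thesis by blast
qed

lemma exists_minimal_sublinear:
  assumes q0: "sublinear q0"
  shows "\<exists>m. sublinear m \<and> m \<le> q0 \<and> (\<forall>q. sublinear q \<longrightarrow> q \<le> m \<longrightarrow> q = m)"
proof -
  define A where "A = {q. sublinear q \<and> q \<le> q0}"
  have "\<exists>m\<in>A. \<forall>a\<in>A. a \<le> m \<longrightarrow> a = m"
  proof (rule predicate_Zorn)
    show "partial_order_on A (relation_of (\<lambda>f g. g \<le> f) A)"
      by (rule partial_order_on_relation_ofI) auto
  next
    fix C assume C: "C \<in> Chains (relation_of (\<lambda>f g. g \<le> f) A)"
    then have CA: "C \<subseteq> A" and lin: "\<And>f g. f \<in> C \<Longrightarrow> g \<in> C \<Longrightarrow> f \<le> g \<or> g \<le> f"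
      unfolding Chains_def relation_of_def by auto
    show "\<exists>u\<in>A. \<forall>a\<in>C. u \<le> a"
    proof (cases "C = {}")
      case True then show ?thesis using q0 unfolding A_def by auto
    next
      case False
      define u where "u v = (INF q\<in>C. q v)" for v
      have bdd: "bdd_below ((\<lambda>q. q v) ` C)" for v
      proof (rule bdd_belowI2)
        fix q assume "q \<in> C"
        then have "sublinear q" "q (- v) \<le> q0 (- v)" using CA unfolding A_def le_fun_def by auto
        then show "- q0 (- v) \<le> q v" using sublinear_ge_neg[of q v] by linarith
      qed
      have "sublinear u"
        unfolding u_def
      proof (rule sublinear_INF)
        fix f g v w assume fg: "f \<in> C" "g \<in> C"
        then obtain k where k: "k \<in> C" "k \<le> f" "k \<le> g" using lin by blast
        then have "k (v + w) \<le> k v + k w" using CA unfolding A_def sublinear_def by blast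
        also have "\<dots> \<le> f v + g w" using k unfolding le_fun_def by (simp add: add_mono)
        finally show "\<exists>k\<in>C. k (v + w) \<le> f v + g w" using k by blast
      next
        fix f c v assume "f \<in> C" "(c::real) \<ge> 0"
        then show "\<exists>k\<in>C. k (c *\<^sub>R v) \<le> c * f v" using CA unfolding A_def sublinear_def by blast
      qed (use False bdd in auto)
      moreover have low: "u \<le> q" if "q \<in> C" for q
        unfolding u_def le_fun_def using bdd that by (auto intro: cINF_lower)
      moreover obtain q where "q \<in> C" using False by blast
      ultimately have "u \<in> A" using CA order_trans unfolding A_def by blast
      then show ?thesis using low by blast
    qed
  qed
  then show ?thesis unfolding A_def using order_trans by blast
qed

text \<open>The Hahn-Banach theorem at a point. A sublinear functional that cannot be lowered in any
  direction is superadditive as well, hence linear; lowering in the direction \<open>x\<close> before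
  minimising fixes the value at \<open>x\<close>.\<close>

lemma exists_linear_below_sublinear:
  assumes q0: "sublinear q0"
  shows "\<exists>f. linear f \<and> (\<forall>v. f v \<le> q0 v) \<and> f x = q0 x"
proof -
  obtain q1 where q1: "sublinear q1" "\<And>v. q1 v \<le> q0 v" "\<And>v. q1 v \<le> q0 (v + x) - q0 x"
    using sublinear_lowering[OF q0] by blast
  obtain f where f: "sublinear f" "f \<le> q1" and min: "\<And>q. sublinear q \<Longrightarrow> q \<le> f \<Longrightarrow> q = f"
    using exists_minimal_sublinear[OF q1(1)] by blast
  have add: "f (v + w) = f v + f w" for v w
  proof -
    obtain q where q: "sublinear q" "\<And>v. q v \<le> f v" "\<And>v. q v \<le> f (v + w) - f w"
      using sublinear_lowering[OF f(1)] by blast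
    then have "q = f" using min unfolding le_fun_def by blast
    then have "f v + f w \<le> f (v + w)" using q(3)[of v] by simp
    moreover have "f (v + w) \<le> f v + f w" using f(1) unfolding sublinear_def by blast
    ultimately show ?thesis by simp
  qed
  have neg: "f (- v) = - f v" for v
    using add[of v "- v"] sublinear_zero[OF f(1)] by simp
  have scale: "f (c *\<^sub>R v) = c * f v" for c v
  proof (cases "c \<ge> 0")
    case True then show ?thesis using sublinear_scaleR[OF f(1)] by blast
  next
    case False
    then show ?thesis using sublinear_scaleR[OF f(1), of "- c" v] neg[of "c *\<^sub>R v"] by simp
  qed
  have le: "f v \<le> q0 v" for v using f(2) q1(2)[of v] order_trans unfolding le_fun_def by blast
  have "f (- x) \<le> q1 (- x)" using f(2) unfolding le_fun_def by blast
  also have "\<dots> \<le> - q0 x" using q1(3)[of "- x"] sublinear_zero[OF q0] by simp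
  finally have "f x = q0 x" using le[of x] neg[of x] by simp
  moreover have "linear f" using add scale by (intro linearI) auto
  ultimately show ?thesis using le by blast
qed

lemma exists_support_functional:
  fixes x :: "'a::real_normed_vector"
  assumes x: "x \<noteq> 0"
  shows "\<exists>p :: 'a \<Rightarrow>\<^sub>L real. norm p = 1 \<and> blinfun_apply p x = norm x"
proof -
  have "sublinear (norm :: 'a \<Rightarrow> real)"
    unfolding sublinear_def by (auto simp: norm_triangle_ineq)
  then obtain f :: "'a \<Rightarrow> real" where f: "linear f" "\<And>v. f v \<le> norm v" "f x = norm x"
    using exists_linear_below_sublinear by blast
  have abs: "norm (f v) \<le> 1 * norm v" for v
    using f(2)[of v] f(2)[of "- v"] linear_neg[OF f(1), of v] by auto
  have "bounded_linear f"
    using abs linear_add[OF f(1)] linear_scale[OF f(1)]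
    by (intro bounded_linear_intro[of f 1]) (simp_all add: mult.commute)
  then have ap: "blinfun_apply (Blinfun f) = f" by (rule bounded_linear_Blinfun_apply)
  have "norm (Blinfun f) = 1"
    using abs f(3) x by (intro norm_blinfun_eqI[of _ _ x]) (simp_all add: ap)
  then show ?thesis using ap f(3) by auto
qed

lemma exists_unit_in_kernel:
  fixes p :: "'a::real_normed_vector \<Rightarrow>\<^sub>L real"
  assumes dim: "\<exists>B :: 'a set. independent B \<and> card B = 2" and x: "blinfun_apply p x = 1"
  shows "\<exists>y. norm y = 1 \<and> blinfun_apply p y = 0"
proof -
  obtain B :: "'a set" where B: "independent B" "card B = 2" using dim by blast
  have "\<not> B \<subseteq> span {x}" using independent_span_bound[of "{x}" B] B by auto
  then obtain z where z: "z \<notin> span {x}" by blast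
  define w where "w = z - blinfun_apply p z *\<^sub>R x"
  have "w \<noteq> 0" using z unfolding w_def by (metis eq_iff_diff_eq_0 insertI1 span_base span_scale)
  moreover have "blinfun_apply p w = 0"
    unfolding w_def using x by (simp add: blinfun.diff_right blinfun.scaleR_right)
  ultimately show ?thesis by (intro exI[of _ "w /\<^sub>R norm w"]) (simp add: blinfun.scaleR_right)
qed

section \<open>The minimal step back to the sphere\<close>

lemma blinfun_le_norm:
  assumes "norm p = 1" shows "blinfun_apply p v \<le> norm v"
  using norm_blinfun[of p v] assms by auto

lemma quasiorthogonal_support:
  fixes x y :: "'a::real_normed_vector"
  assumes "quasiorthogonal y x" "norm x = 1"
  shows "\<exists>p. (\<forall>v. blinfun_apply p v \<le> norm v) \<and> blinfun_apply p x = 1 \<and> blinfun_apply p y = 0"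
proof -
  obtain p :: "'a \<Rightarrow>\<^sub>L real" where "norm p = 1" "blinfun_apply p x = 1" "blinfun_apply p y = 0"
    using assms unfolding quasiorthogonal_def by auto
  then show ?thesis using blinfun_le_norm by blast
qed

text \<open>The norm of \<open>(1 - l) x + r y\<close> is at least \<open>1 - l\<close> by the support functional. This excludes
  \<open>l < 0\<close> and gives a value \<open>\<ge> 1\<close> at \<open>l = 0\<close>, so the intermediate value theorem places a
  solution before any \<open>l = 1 - s\<close> at which the point is back in the ball.\<close>

lemma supporting_lambda_le:
  fixes x y :: "'a::real_normed_vector"
  assumes x: "norm x = 1" and qo: "quasiorthogonal y x"
    and s: "s \<le> 1" and in_ball: "norm (s *\<^sub>R x + r *\<^sub>R y) \<le> 1"
  shows "norm (x + r *\<^sub>R y - supporting_lambda x y r *\<^sub>R x) = 1"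
    and "0 \<le> supporting_lambda x y r"
    and "supporting_lambda x y r \<le> 1 - s"
proof -
  obtain p where p: "\<And>v. blinfun_apply p v \<le> norm v" "blinfun_apply p x = 1" "blinfun_apply p y = 0"
    using quasiorthogonal_support[OF qo x] by blast
  define \<phi> where "\<phi> l = norm (x + r *\<^sub>R y - l *\<^sub>R x)" for l
  have cont: "continuous_on T \<phi>" for T unfolding \<phi>_def by (intro continuous_intros)
  have ge: "1 - l \<le> \<phi> l" for l
    using p(1)[of "x + r *\<^sub>R y - l *\<^sub>R x"] p(2,3) unfolding \<phi>_def
    by (simp add: blinfun.add_right blinfun.diff_right blinfun.scaleR_right)
  have "\<phi> (1 - s) \<le> 1" using in_ball unfolding \<phi>_def by (simp add: algebra_simps)
  then obtain l0 where l0: "0 \<le> l0" "l0 \<le> 1 - s" "\<phi> l0 = 1"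
    using IVT2'[of \<phi> "1 - s" 1 0] ge[of 0] s cont by auto
  define Z where "Z = {l. \<phi> l = 1}"
  have lower: "0 \<le> l" if "l \<in> Z" for l using ge[of l] that unfolding Z_def by simp
  have closed: "closed Z"
    using continuous_closed_preimage[OF cont closed_UNIV, of "{1}"]
    unfolding Z_def vimage_def by simp
  have ne: "Z \<noteq> {}" using l0(3) unfolding Z_def by blast
  have bdd: "bdd_below Z" using lower by (rule bdd_belowI)
  have InfZ: "Inf Z \<in> Z" using closed_contains_Inf[OF ne bdd closed] .
  have "supporting_lambda x y r = Inf Z"
    unfolding supporting_lambda_def
  proof (rule Least_equality)
    show "norm (x + r *\<^sub>R y - Inf Z *\<^sub>R x) = 1" using InfZ unfolding Z_def \<phi>_def by simp
    fix l assume "norm (x + r *\<^sub>R y - l *\<^sub>R x) = 1"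
    then show "Inf Z \<le> l" using bdd by (intro cInf_lower) (simp_all add: Z_def \<phi>_def)
  qed
  moreover have "Inf Z \<le> l0" using l0(3) bdd by (intro cInf_lower) (auto simp: Z_def)
  ultimately show "norm (x + r *\<^sub>R y - supporting_lambda x y r *\<^sub>R x) = 1"
    "0 \<le> supporting_lambda x y r" "supporting_lambda x y r \<le> 1 - s"
    using InfZ lower l0(2) unfolding Z_def \<phi>_def by auto
qed

section \<open>The two inequalities\<close>

lemma modulus_convexity_le:
  fixes u v :: "'a::real_normed_vector"
  assumes "norm u \<le> 1" "norm v \<le> 1" "\<epsilon> \<le> norm (u - v)"
  shows "modulus_convexity TYPE('a) \<epsilon> \<le> 1 - norm (u + v) / 2"
  unfolding modulus_convexity_def
proof (rule cInf_lower)
  show "bdd_below {1 - norm (x + y) / 2 | x y :: 'a.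
      x \<in> cball 0 1 \<and> y \<in> cball 0 1 \<and> \<epsilon> \<le> norm (x - y)}"
  proof (rule bdd_belowI[of _ 0], clarsimp)
    fix x y :: 'a assume "norm x \<le> 1" "norm y \<le> 1"
    then show "norm (x + y) \<le> 2" using norm_triangle_ineq[of x y] by linarith
  qed
qed (use assms in auto)

text \<open>An antipodal pair of unit vectors shows that the infimum is over a nonempty set.\<close>

lemma modulus_convexity_greatest:
  fixes x0 :: "'a::real_normed_vector"
  assumes x0: "norm x0 = 1" and \<epsilon>: "\<epsilon> \<le> 2"
    and bound: "\<And>u v :: 'a. norm u \<le> 1 \<Longrightarrow> norm v \<le> 1 \<Longrightarrow> \<epsilon> \<le> norm (u - v)
      \<Longrightarrow> m \<le> 1 - norm (u + v) / 2"
  shows "m \<le> modulus_convexity TYPE('a) \<epsilon>"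
  unfolding modulus_convexity_def
proof (rule cInf_greatest)
  have "norm (x0 - - x0) = 2" using x0 by (simp flip: scaleR_2)
  then have "1 - norm (x0 + - x0) / 2 \<in> {1 - norm (x + y) / 2 | x y :: 'a.
      x \<in> cball 0 1 \<and> y \<in> cball 0 1 \<and> \<epsilon> \<le> norm (x - y)}"
    using x0 \<epsilon> by (intro CollectI exI[of _ x0] exI[of _ "- x0"]) simp
  then show "{1 - norm (x + y) / 2 | x y :: 'a.
      x \<in> cball 0 1 \<and> y \<in> cball 0 1 \<and> \<epsilon> \<le> norm (x - y)} \<noteq> {}"
    by blast
qed (use bound in auto)

lemma modulus_convexity_le_supporting_lambda:
  fixes x y :: "'a::real_normed_vector"
  assumes x: "norm x = 1" and y: "norm y = 1" and qo: "quasiorthogonal y x"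
    and r: "0 \<le> r" "r \<le> 1"
  shows "modulus_convexity TYPE('a) r \<le> supporting_lambda x y r"
proof -
  obtain p where p: "\<And>v. blinfun_apply p v \<le> norm v" "blinfun_apply p x = 1" "blinfun_apply p y = 0"
    using quasiorthogonal_support[OF qo x] by blast
  define l where "l = supporting_lambda x y r"
  have l: "norm (x + r *\<^sub>R y - l *\<^sub>R x) = 1" "0 \<le> l" "l \<le> 1"
    using supporting_lambda_le[OF x qo, of 0 r] y r unfolding l_def by auto
  define z where "z = x + r *\<^sub>R y - l *\<^sub>R x"
  define w where "w = (1 - l) *\<^sub>R x"
  have "z - w = r *\<^sub>R y" unfolding z_def w_def by (simp add: algebra_simps)
  then have "norm (z - w) = r" using y r by simp
  moreover have "norm z \<le> 1" "norm w \<le> 1" using l x unfolding z_def w_def by auto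
  ultimately have "modulus_convexity TYPE('a) r \<le> 1 - norm (z + w) / 2"
    by (intro modulus_convexity_le) simp_all
  moreover have "2 * (1 - l) \<le> norm (z + w)"
    using p(1)[of "z + w"] p(2,3) unfolding z_def w_def
    by (simp add: blinfun.add_right blinfun.diff_right blinfun.scaleR_right)
  ultimately show ?thesis unfolding l_def by simp
qed

lemma norm_combination_le_1:
  fixes v w :: "'a::real_normed_vector"
  assumes "norm v \<le> 1" "norm w \<le> 1" "0 \<le> a" "0 \<le> b" "a + b \<le> 1"
  shows "norm (a *\<^sub>R v + b *\<^sub>R w) \<le> 1"
proof -
  have "norm (a *\<^sub>R v + b *\<^sub>R w) \<le> a * norm v + b * norm w"
    using norm_triangle_ineq[of "a *\<^sub>R v" "b *\<^sub>R w"] assms by simp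
  also have "\<dots> \<le> a * 1 + b * 1" using assms by (intro add_mono mult_left_mono) auto
  finally show ?thesis using assms by simp
qed

text \<open>The heart of the upper bound. Let \<open>w = (s + a) x + b y\<close> and \<open>t = s / (s + a)\<close>; the multiple
  \<open>t w\<close> has the \<open>x\<close>-coordinate \<open>s\<close>. If its height \<open>t b\<close> is at most \<open>r\<close>, then \<open>s x + r y\<close> is reached
  from \<open>t w\<close> by adding a multiple of \<open>y\<close>; otherwise it is reached from \<open>(r / b) w\<close>, of
  height \<open>r\<close>, by adding a multiple of \<open>x\<close>. In the first case the weights sum up to at most
  \<open>1\<close> exactly when \<open>r (s + a) \<le> a + b s\<close>. This is what the lower bound on the norm of
  \<open>a x + b y\<close> yields, since \<open>(s + a) (a x + b y) = a w + b s y\<close>.\<close>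

lemma shifted_midpoint_in_ball:
  fixes x y :: "'a::real_normed_vector"
  assumes x: "norm x = 1" and y: "norm y = 1"
    and pos: "0 \<le> s" "0 \<le> a" "0 \<le> b" and sa: "s + a \<le> 1" and r: "0 \<le> r" "r \<le> 1"
    and ball: "norm ((s + a) *\<^sub>R x + b *\<^sub>R y) \<le> 1"
    and long: "r \<le> norm (a *\<^sub>R x + b *\<^sub>R y)"
  shows "norm (s *\<^sub>R x + r *\<^sub>R y) \<le> 1"
proof (cases "s = 0")
  case True
  then show ?thesis using y r by simp
next
  case False
  define w where "w = (s + a) *\<^sub>R x + b *\<^sub>R y"
  define t where "t = s / (s + a)"
  have sa_pos: "s + a > 0" using False pos by simp
  have t_s: "t * (s + a) = s" using sa_pos unfolding t_def by simp
  have t0: "0 \<le> t" using pos unfolding t_def by simp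
  have "(s + a) * r \<le> norm ((s + a) *\<^sub>R (a *\<^sub>R x + b *\<^sub>R y))"
    using long sa_pos by simp
  also have "(s + a) *\<^sub>R (a *\<^sub>R x + b *\<^sub>R y) = a *\<^sub>R w + (b * s) *\<^sub>R y"
    unfolding w_def by (simp add: algebra_simps)
  also have "norm \<dots> \<le> a * norm w + b * s"
    using norm_triangle_ineq[of "a *\<^sub>R w" "(b * s) *\<^sub>R y"] pos y by simp
  also have "\<dots> \<le> a + b * s"
    using ball pos mult_left_le[of "norm w" a] unfolding w_def by simp
  finally have "(s + a) * r \<le> a + b * s" .
  then have "(s + a) * (t * (1 - b)) \<le> (s + a) * (1 - r)"
    using t_s by (simp add: algebra_simps)
  then have weights: "t * (1 - b) \<le> 1 - r" using sa_pos by simp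
  show ?thesis
  proof (cases "t * b \<le> r")
    case True
    have "s *\<^sub>R x + r *\<^sub>R y = t *\<^sub>R w + (r - t * b) *\<^sub>R y"
      using t_s unfolding w_def by (simp add: algebra_simps flip: scaleR_left_distrib)
    moreover have "norm (t *\<^sub>R w + (r - t * b) *\<^sub>R y) \<le> 1"
      using ball y t0 True weights
      by (intro norm_combination_le_1) (auto simp: w_def algebra_simps)
    ultimately show ?thesis by simp
  next
    case False
    then have b: "b > 0" using pos r by (cases "b = 0") auto
    define k where "k = r / b"
    have k_b: "k * b = r" using b unfolding k_def by simp
    have k0: "0 \<le> k" using b r unfolding k_def by simp
    have "k < t" using False b unfolding k_def by (simp add: field_simps)
    then have k_s: "k * (s + a) \<le> s" using t_s sa_pos by (metis less_imp_le mult_right_mono)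
    have "t \<le> 1" unfolding t_def using pos sa_pos by simp
    then have "k \<le> 1" using \<open>k < t\<close> by simp
    then have "k * (1 - (s + a)) \<le> 1 - (s + a)"
      using sa by (intro mult_left_le_one_le k0) auto
    then have "k + (s - k * (s + a)) \<le> 1"
      using pos by (simp add: algebra_simps)
    then have "norm (k *\<^sub>R w + (s - k * (s + a)) *\<^sub>R x) \<le> 1"
      using ball x k0 k_s by (intro norm_combination_le_1) (auto simp: w_def)
    moreover have "s *\<^sub>R x + r *\<^sub>R y = k *\<^sub>R w + (s - k * (s + a)) *\<^sub>R x"
      using k_b unfolding w_def by (simp add: algebra_simps flip: scaleR_left_distrib)
    ultimately show ?thesis by simp
  qed
qed

text \<open>The kernel of a support functional \<open>p\<close> at \<open>x\<close> is complementary to \<open>x\<close>, so \<open>h\<close> splits as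
  \<open>p h\<close> times \<open>x\<close> plus a kernel vector. The dimension is what provides a unit kernel vector when
  \<open>h\<close> is a multiple of \<open>x\<close>.\<close>

lemma exists_quasiorthogonal_decomposition:
  fixes x h :: "'a::real_normed_vector"
  assumes dim: "\<exists>B :: 'a set. independent B \<and> card B = 2" and x: "norm x = 1"
  shows "\<exists>y a b. norm y = 1 \<and> quasiorthogonal y x \<and> 0 \<le> b \<and> h = a *\<^sub>R x + b *\<^sub>R y"
proof -
  have x0: "x \<noteq> 0" using x by auto
  then obtain p :: "'a \<Rightarrow>\<^sub>L real" where p: "norm p = 1" "blinfun_apply p x = norm x"
    using exists_support_functional by blast
  have qo: "quasiorthogonal y x" if "blinfun_apply p y = 0" for y
    unfolding quasiorthogonal_def using x0 p that by blast
  define k where "k = h - blinfun_apply p h *\<^sub>R x"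
  have pk: "blinfun_apply p k = 0"
    unfolding k_def using p x by (simp add: blinfun.diff_right blinfun.scaleR_right)
  show ?thesis
  proof (cases "k = 0")
    case True
    obtain y where y: "norm y = 1" "blinfun_apply p y = 0"
      using exists_unit_in_kernel[OF dim, of p x] p x by auto
    have "h = blinfun_apply p h *\<^sub>R x + 0 *\<^sub>R y" using True unfolding k_def by simp
    then show ?thesis using y qo by blast
  next
    case False
    define y where "y = k /\<^sub>R norm k"
    have "norm y = 1" "blinfun_apply p y = 0"
      using False pk unfolding y_def by (simp_all add: blinfun.scaleR_right)
    moreover have "h = blinfun_apply p h *\<^sub>R x + norm k *\<^sub>R y"
      using False unfolding y_def by (simp add: k_def)
    ultimately show ?thesis using qo norm_ge_zero by blast
  qed
qed

lemma exists_supporting_lambda_le: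
  fixes u v :: "'a::real_normed_vector"
  assumes dim: "\<exists>B :: 'a set. independent B \<and> card B = 2"
    and uv: "norm u \<le> 1" "norm v \<le> 1" "2 * r \<le> norm (u - v)" and r: "0 \<le> r" "r \<le> 1"
  shows "\<exists>x y :: 'a. norm x = 1 \<and> norm y = 1 \<and> quasiorthogonal y x
           \<and> supporting_lambda x y r \<le> 1 - norm (u + v) / 2"
proof -
  define s where "s = norm (u + v) / 2"
  obtain B :: "'a set" where B: "independent B" "card B = 2" using dim by blast
  have "B \<noteq> {}" using B(2) by force
  then obtain e where "e \<in> B" by blast
  then have e: "e \<noteq> 0" using B(1) dependent_zero by blast
  \<comment> \<open>If the midpoint is \<open>0\<close>, then any direction will do.\<close>
  define x where "x = (if u + v = 0 then e /\<^sub>R norm e else (u + v) /\<^sub>R norm (u + v))"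
  have x: "norm x = 1" using e unfolding x_def by simp
  have mid: "u + v = (2 * s) *\<^sub>R x" unfolding s_def x_def by simp
  have s: "0 \<le> s" "s \<le> 1" using norm_triangle_ineq[of u v] uv unfolding s_def by auto
  obtain y a b where y: "norm y = 1" and qo: "quasiorthogonal y x" and b: "0 \<le> b"
    and h: "(1/2) *\<^sub>R (u - v) = a *\<^sub>R x + b *\<^sub>R y"
    using exists_quasiorthogonal_decomposition[OF dim x, of "(1/2) *\<^sub>R (u - v)"] by blast
  have half: "(1/2) *\<^sub>R (u + v) = s *\<^sub>R x" unfolding mid by simp
  have "u = (1/2) *\<^sub>R (u + v) + (1/2) *\<^sub>R (u - v)"
    by (simp flip: scaleR_add_right scaleR_diff_right)
  then have u: "u = (s + a) *\<^sub>R x + b *\<^sub>R y"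
    unfolding half h by (simp add: algebra_simps)
  have "v = (1/2) *\<^sub>R (u + v) - (1/2) *\<^sub>R (u - v)"
    by (simp flip: scaleR_diff_right)
  then have v: "v = (s - a) *\<^sub>R x - b *\<^sub>R y"
    unfolding half h by (simp add: algebra_simps)
  have "norm ((1/2) *\<^sub>R (u - v)) = norm (u - v) / 2" by simp
  then have long: "r \<le> norm (a *\<^sub>R x + b *\<^sub>R y)" using uv(3) unfolding h by linarith
  obtain p where p: "\<And>z. blinfun_apply p z \<le> norm z" "blinfun_apply p x = 1" "blinfun_apply p y = 0"
    using quasiorthogonal_support[OF qo x] by blast
  have "blinfun_apply p u = s + a" "blinfun_apply p v = s - a"
    unfolding u v using p(2,3)
    by (simp_all add: blinfun.add_right blinfun.diff_right blinfun.scaleR_right)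
  then have sa: "s + a \<le> 1" "s - a \<le> 1" using p(1)[of u] p(1)[of v] uv by auto
  \<comment> \<open>The sign of \<open>a\<close> decides which of \<open>u\<close>, \<open>v\<close> lies ahead of the midpoint. If it is \<open>v\<close>, then
    \<open>-y\<close> takes the place of \<open>y\<close>.\<close>
  obtain y' where y': "norm y' = 1" "quasiorthogonal y' x" "norm (s *\<^sub>R x + r *\<^sub>R y') \<le> 1"
  proof (cases "a \<ge> 0")
    case True
    then have "norm (s *\<^sub>R x + r *\<^sub>R y) \<le> 1"
      using shifted_midpoint_in_ball[OF x y s(1) _ b sa(1) r] uv(1) long unfolding u by blast
    then show ?thesis using that y qo by blast
  next
    case False
    have "norm (s *\<^sub>R x + r *\<^sub>R (- y)) \<le> 1"
    proof (rule shifted_midpoint_in_ball[of x "- y" s "- a" b r])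
      show "norm ((s + - a) *\<^sub>R x + b *\<^sub>R - y) \<le> 1" using uv(2) unfolding v by simp
      have "- a *\<^sub>R x + b *\<^sub>R - y = - (a *\<^sub>R x + b *\<^sub>R y)" by simp
      then show "r \<le> norm (- a *\<^sub>R x + b *\<^sub>R - y)" using long by (metis norm_minus_cancel)
    qed (use x y s b sa r False in auto)
    moreover have "quasiorthogonal (- y) x"
      using qo unfolding quasiorthogonal_def by (auto simp: blinfun.minus_right)
    ultimately show ?thesis using that[of "- y"] y by simp
  qed
  then have "supporting_lambda x y' r \<le> 1 - s"
    using supporting_lambda_le(3)[OF x] s by blast
  then show ?thesis using x y' unfolding s_def by blast
qed

theorem theorem1:
  assumes dim_ge_2: "\<exists>B :: 'a::banach set. independent B \<and> card B = 2"
  shows "equivalent_at_zero 1 (modulus_supporting_convexity TYPE('a))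
           2 (modulus_convexity TYPE('a)) \<and>
         (\<forall>r\<in>{0..1}.
           modulus_convexity TYPE('a) r \<le> modulus_supporting_convexity TYPE('a) r \<and>
           modulus_supporting_convexity TYPE('a) r \<le> modulus_convexity TYPE('a) (2 * r))"
proof -
  let ?d = "modulus_convexity TYPE('a)" and ?l = "modulus_supporting_convexity TYPE('a)"
  obtain x0 y0 :: 'a where x0: "norm x0 = 1" "norm y0 = 1" "quasiorthogonal y0 x0"
    using exists_supporting_lambda_le[OF dim_ge_2, of 0 0 0] by auto
  have lower: "?d r \<le> ?l r" if r: "r \<in> {0..1}" for r
    unfolding modulus_supporting_convexity_def
    using x0 r
    by (intro cInf_greatest) (auto intro!: modulus_convexity_le_supporting_lambda)
  have upper: "?l r \<le> ?d (2 * r)" if r: "r \<in> {0..1}" for r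
  proof (rule modulus_convexity_greatest[OF x0(1)])
    show "2 * r \<le> 2" using r by simp
    fix u v :: 'a assume uv: "norm u \<le> 1" "norm v \<le> 1" "2 * r \<le> norm (u - v)"
    obtain x y :: 'a where xy: "norm x = 1" "norm y = 1" "quasiorthogonal y x"
      "supporting_lambda x y r \<le> 1 - norm (u + v) / 2"
      using exists_supporting_lambda_le[OF dim_ge_2 uv] r by auto
    have "0 \<le> supporting_lambda x y r"
      if "norm x = 1" "norm y = 1" "quasiorthogonal y x" for x y :: 'a
      using supporting_lambda_le(2)[of x y 0 r] that r by simp
    then have "bdd_below {supporting_lambda x y r | x y :: 'a.
        x \<in> sphere 0 1 \<and> y \<in> sphere 0 1 \<and> quasiorthogonal y x}"
      by (intro bdd_belowI[of _ 0]) auto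
    then have "?l r \<le> supporting_lambda x y r"
      unfolding modulus_supporting_convexity_def using xy by (intro cInf_lower) auto
    then show "?l r \<le> 1 - norm (u + v) / 2" using xy(4) by simp
  qed
  have d_nonneg: "0 \<le> ?d t" if "t \<in> {0..2}" for t
  proof (rule modulus_convexity_greatest[OF x0(1)])
    fix u v :: 'a assume "norm u \<le> 1" "norm v \<le> 1"
    then show "0 \<le> 1 - norm (u + v) / 2" using norm_triangle_ineq[of u v] by simp
  qed (use that in simp)
  have l_nonneg: "0 \<le> ?l t" if "t \<in> {0..1}" for t
    using lower[OF that] d_nonneg[of t] that by auto
  have near0: "\<forall>t\<in>{0..1}. t \<in> {0..2} \<and> 1/2 * t \<in> {0..1} \<and> 1 * t \<in> {0..1} \<and>
      1 * ?l (1/2 * t) \<le> ?d t \<and> ?d t \<le> 1 * ?l (1 * t)"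
  proof
    fix t :: real assume t: "t \<in> {0..1}"
    then show "t \<in> {0..2} \<and> 1/2 * t \<in> {0..1} \<and> 1 * t \<in> {0..1} \<and>
        1 * ?l (1/2 * t) \<le> ?d t \<and> ?d t \<le> 1 * ?l (1 * t)"
      using lower[OF t] upper[of "1/2 * t"] by auto
  qed
  have "\<exists>a b c d e :: real. a > 0 \<and> b > 0 \<and> c > 0 \<and> d > 0 \<and> e > 0 \<and>
      (\<forall>t\<in>{0..e}. t \<in> {0..2} \<and> b * t \<in> {0..1} \<and> d * t \<in> {0..1} \<and>
         a * ?l (b * t) \<le> ?d t \<and> ?d t \<le> c * ?l (d * t))"
    by (rule exI[of _ 1], rule exI[of _ "1/2"], rule exI[of _ 1], rule exI[of _ 1],
        rule exI[of _ 1]) (use near0 in simp)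
  then have "equivalent_at_zero 1 ?l 2 ?d"
    unfolding equivalent_at_zero_def using d_nonneg l_nonneg by blast
  then show ?thesis using lower upper by blast
qed

end
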